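(* Let $\alpha=10^{-4}$ and, for each $n\in\mathbb{N}$, let $T=\lfloor (1-n^{-\alpha})n\rfloor$. With probability $1-\exp\left(-\Omega\left(n^{0.01}\right)\right)$ (as $n\to\infty$), the toroidal random greedy algorithm, run on the $n \times n$ board for $T$ steps, does not abort. That is, there are constants $c>0$ and $n_0$ such that for all $n\ge n_0$ this happens with probability at least $1-\exp(-c\,n^{0.01})$.
   Context: Write $[n]=\{1,\dots,n\}$ and identify the $n\times n$ chessboard with $[n]^2$. The toroidal diagonals containing $(x,y)\in[n]^2$ are $\{(x',y')\in [n]^2: x'+y' \equiv x+y \pmod n\}$ and $\{(x',y')\in [n]^2: x'-y' \equiv x-y \pmod n\}$. The toroidal random greedy algorithm: set $Q(0)=\emptyset$. For each $0\le t<T$ let $\mathcal{A}(t)\subseteq[n]^2$ be the set of available positions, i.e. those positions whose row, column and both toroidal diagonals contain no element of $Q(t)$. If $\mathcal{A}(t)=\emptyset$, abort. Otherwise choose $(x_t,y_t)\in\mathcal{A}(t)$ uniformly at random, independently of previous choices, and set $Q(t+1)=Q(t)\cup\{(x_t,y_t)\}$. *)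

theory Defs
  imports "HOL-Probability.Probability" "HOL-Number_Theory.Cong"
begin

definition board :: "nat \<Rightarrow> (nat \<times> nat) set" where
  "board n = {1..n} \<times> {1..n}"

definition board_column :: "nat \<Rightarrow> nat \<times> nat \<Rightarrow> (nat \<times> nat) set" where
  "board_column n p = {q \<in> board n. fst q = fst p}"

definition board_row :: "nat \<Rightarrow> nat \<times> nat \<Rightarrow> (nat \<times> nat) set" where
  "board_row n p = {q \<in> board n. snd q = snd p}"

definition toroidal_plus_diagonal :: "nat \<Rightarrow> nat \<times> nat \<Rightarrow> (nat \<times> nat) set" where
  "toroidal_plus_diagonal n p =
     {q \<in> board n. [int (fst q) + int (snd q) = int (fst p) + int (snd p)] (mod int n)}"

definition toroidal_minus_diagonal :: "nat \<Rightarrow> nat \<times> nat \<Rightarrow> (nat \<times> nat) set" where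
  "toroidal_minus_diagonal n p =
     {q \<in> board n. [int (fst q) - int (snd q) = int (fst p) - int (snd p)] (mod int n)}"

definition available :: "nat \<Rightarrow> (nat \<times> nat) set \<Rightarrow> (nat \<times> nat) set" where
  "available n Q =
     {p \<in> board n. board_row n p \<inter> Q = {} \<and> board_column n p \<inter> Q = {} \<and>
        toroidal_plus_diagonal n p \<inter> Q = {} \<and> toroidal_minus_diagonal n p \<inter> Q = {}}"

definition greedy_step :: "nat \<Rightarrow> (nat \<times> nat) set \<Rightarrow> (nat \<times> nat) set option pmf" where
  "greedy_step n Q =
     (if available n Q = {} then return_pmf None
      else map_pmf (\<lambda>p. Some (insert p Q)) (pmf_of_set (available n Q)))"

(* The law of the state after t steps: None if the algorithm has aborted at one of
   the steps 0, ..., t - 1, and Some Q if it has not and Q(t) = Q. *)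
primrec toroidal_greedy :: "nat \<Rightarrow> nat \<Rightarrow> (nat \<times> nat) set option pmf" where
  "toroidal_greedy n 0 = return_pmf (Some {})"
| "toroidal_greedy n (Suc t) =
     bind_pmf (toroidal_greedy n t)
       (\<lambda>s. case s of None \<Rightarrow> return_pmf None | Some Q \<Rightarrow> greedy_step n Q)"

definition greedy_alpha :: real where
  "greedy_alpha = 1 / 10 ^ 4"

definition greedy_time :: "nat \<Rightarrow> nat" where
  "greedy_time n = nat \<lfloor>(1 - real n powr (- greedy_alpha)) * real n\<rfloor>"

end

theory Submission
  imports Defs "HOL-Real_Asymp.Real_Asymp"
begin

text \<open>For every line (row, column or toroidal diagonal) without a queen, follow the number of available
  cells on it. After \<open>t\<close> steps \<open>m = n - t\<close> lines of each family are open, and all these numbers are expected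
  to be close to \<open>a = m ^ 3 / n\<^sup>2\<close>. This system is closed: if all open lines have about \<open>a\<close> available cells,
  then the board has about \<open>m a\<close> of them, and each available cell of a line is lost through one of the three
  other lines through it, so a line loses about \<open>3 a\<^sup>2 / (m a) = 3 a / m\<close> cells per step, which is the
  decrease of the trajectory \<open>a\<close>. Distinct lines meet in at most two cells (\<open>card_meet_le_2\<close>), so the overlaps
  cost only a constant and one queen removes at most six cells from a line.

  Deviations are allowed to grow as \<open>e = g (n / m) ^ 13\<close>. A deviation of at most \<open>e\<close> on all lines perturbs the
  drift by about \<open>12 e / m\<close> (\<open>drift_bounds\<close>), which the growth \<open>13 e / m\<close> of the tolerance dominates. Up to
  \<open>m = n powr (1 - 1 / 10 ^ 4)\<close> the ratio \<open>e / a\<close> stays small when \<open>g = n powr (3/4)\<close>.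

  Concentration comes from one exponential potential, the sum over open lines and both signs of
  \<open>exp (l (\<plusminus> (L - a) - e))\<close>, where \<open>L\<close> is the number of available cells of the line. A potential below 1
  forces all deviations to be at most \<open>e\<close>; then there are available cells and the expected potential does
  not increase (\<open>weight_step\<close>, \<open>potential_step\<close>). Hence the expectation of the potential truncated at 1, with value 1
  after an abort, never increases (\<open>score_step\<close>), without any stopping time or union bound over the steps.
  Its initial value \<open>8 n exp (- l g)\<close> therefore bounds the probability of an abort
  (\<open>abort_probability_le\<close>), and \<open>l = n powr (-1/2)\<close> makes it smaller than \<open>exp (- (n powr (1/100)))\<close>.\<close>

section \<open>Lines of the torus\<close>

text \<open>The four families of lines are indexed by \<open>i < 4\<close>: columns, rows, plus diagonals, minus diagonals.
  A line is a pair of such an \<open>i\<close> and a residue modulo \<open>n\<close>; reducing rows and columns modulo \<open>n\<close> as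
  well lets all four families be treated by one argument.\<close>

definition coord :: "nat \<Rightarrow> nat \<Rightarrow> nat \<times> nat \<Rightarrow> int" where
  "coord n i p =
     (if i = 0 then int (fst p) else if i = 1 then int (snd p)
      else if i = 2 then int (fst p) + int (snd p) else int (fst p) - int (snd p)) mod int n"

definition line_cells :: "nat \<Rightarrow> (nat \<times> nat) set \<Rightarrow> nat \<Rightarrow> int \<Rightarrow> (nat \<times> nat) set" where
  "line_cells n Q i c = {p \<in> available n Q. coord n i p = c}"

text \<open>Only lines without a queen are followed; a line that receives a queen has no available cell and
  leaves the system.\<close>

definition open_lines :: "nat \<Rightarrow> (nat \<times> nat) set \<Rightarrow> nat \<Rightarrow> int set" where
  "open_lines n Q i = {0..<int n} - coord n i ` Q"

lemma dvd_small_eq_0: "int n dvd d \<Longrightarrow> \<bar>d\<bar> < int n \<Longrightarrow> d = 0"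
  using dvd_imp_le_int[of d "int n"] by auto

lemma residue_eq_iff:
  assumes "x \<in> {1..n}" "y \<in> {1..n}"
  shows "int x mod int n = int y mod int n \<longleftrightarrow> x = y"
proof
  assume "int x mod int n = int y mod int n"
  then have "int n dvd int x - int y" by (simp add: mod_eq_dvd_iff)
  moreover have "\<bar>int x - int y\<bar> < int n" using assms by auto
  ultimately have "int x - int y = 0" by (rule dvd_small_eq_0)
  then show "x = y" by simp
qed simp

lemma less_4_cases: "(i::nat) < 4 \<Longrightarrow> i = 0 \<or> i = 1 \<or> i = 2 \<or> i = 3" by auto

lemma all_less_4: "(\<forall>i<4::nat. P i) \<longleftrightarrow> P 0 \<and> P 1 \<and> P 2 \<and> P 3"
  by (auto dest!: less_4_cases)

lemma available_iff_coord:
  assumes "Q \<subseteq> board n"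
  shows "p \<in> available n Q \<longleftrightarrow> p \<in> board n \<and> (\<forall>i<4. coord n i p \<notin> coord n i ` Q)"
proof (cases "p \<in> board n")
  case True
  have "board_column n p \<inter> Q = {q \<in> Q. coord n 0 q = coord n 0 p}"
    using assms True residue_eq_iff[of _ n] by (auto simp: board_column_def board_def coord_def)
  moreover have "board_row n p \<inter> Q = {q \<in> Q. coord n 1 q = coord n 1 p}"
    using assms True residue_eq_iff[of _ n] by (auto simp: board_row_def board_def coord_def)
  moreover have "toroidal_plus_diagonal n p \<inter> Q = {q \<in> Q. coord n 2 q = coord n 2 p}"
    using assms by (auto simp: toroidal_plus_diagonal_def cong_def coord_def)
  moreover have "toroidal_minus_diagonal n p \<inter> Q = {q \<in> Q. coord n 3 q = coord n 3 p}"
    using assms by (auto simp: toroidal_minus_diagonal_def cong_def coord_def)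
  moreover have "{q \<in> Q. coord n i q = coord n i p} = {} \<longleftrightarrow> coord n i p \<notin> coord n i ` Q" for i
    unfolding image_iff by fastforce
  ultimately show ?thesis using True
    unfolding available_def all_less_4 by simp blast
qed (simp add: available_def)

lemma coord_range: "n > 0 \<Longrightarrow> coord n i p \<in> {0..<int n}"
  by (simp add: coord_def)

lemma finite_available [simp]: "finite (available n Q)"
  by (rule finite_subset[of _ "board n"]) (auto simp: available_def board_def)

lemma finite_line_cells [simp]: "finite (line_cells n Q i c)"
  by (simp add: line_cells_def)

lemma finite_open_lines [simp]: "finite (open_lines n Q i)"
  by (simp add: open_lines_def)

lemma coord_available_open:
  assumes "Q \<subseteq> board n" "n > 0" "v \<in> available n Q" "i < 4"
  shows "coord n i v \<in> open_lines n Q i"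
  using assms coord_range[of n i v] by (auto simp: open_lines_def available_iff_coord)

text \<open>One coordinate of a cell can be chosen freely on a line and then determines the other one: the
  column for rows and diagonals, the row for columns.\<close>

lemma card_board_line:
  assumes n: "n > 0" and c: "c \<in> {0..<int n}" and i: "i < 4"
  shows "card {p \<in> board n. coord n i p = c} = n"
proof -
  \<comment> \<open>The representative of a residue among \<open>1, ..., n\<close>, where \<open>n\<close> represents 0.\<close>
  define rep where "rep r = nat (if r mod int n = 0 then int n else r mod int n)" for r
  have rep_in: "rep r \<in> {1..n}" for r
  proof -
    have *: "r mod int n < int n" "0 \<le> r mod int n" using n by simp_all
    show "rep r \<in> {1..n}" using n * unfolding rep_def by (auto; linarith)
  qed
  have rep: "int y mod int n = r mod int n \<longleftrightarrow> y = rep r" if "y \<in> {1..n}" for y r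
  proof -
    have "int (rep r) mod int n = r mod int n" using n unfolding rep_def by auto
    then show ?thesis using residue_eq_iff[OF that rep_in, of r] by simp
  qed
  have cm: "c = c mod int n" using c by simp
  have e2: "(int x + int y) mod int n = c \<longleftrightarrow> int y mod int n = (c - int x) mod int n" for x y
    by (subst cm) (simp add: mod_eq_dvd_iff algebra_simps)
  have e3: "(int x - int y) mod int n = c \<longleftrightarrow> int y mod int n = (int x - c) mod int n" for x y
    by (subst cm) (subst mod_eq_dvd_iff, subst mod_eq_dvd_iff, subst dvd_minus_iff[symmetric], simp add: algebra_simps)
  have e0: "int y mod int n = c \<longleftrightarrow> int y mod int n = c mod int n" for y
    using cm by simp
  define f where "f t = (if i = 0 then (rep c, t) else if i = 1 then (t, rep c)
     else if i = 2 then (t, rep (c - int t)) else (t, rep (int t - c)))" for t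
  have "{p \<in> board n. coord n i p = c} = f ` {1..n}"
  proof (intro set_eqI)
    fix p :: "nat \<times> nat"
    obtain x y where p: "p = (x, y)" by (cases p)
    show "p \<in> {p \<in> board n. coord n i p = c} \<longleftrightarrow> p \<in> f ` {1..n}"
      using less_4_cases[OF i] rep_in unfolding p
      by (elim disjE) (auto simp: board_def coord_def f_def e0 e2 e3 rep simp del: atLeastAtMost_iff)
  qed
  moreover have "inj_on f {1..n}" by (auto simp: inj_on_def f_def split: if_splits)
  ultimately show ?thesis by (simp add: card_image)
qed

text \<open>The difference \<open>(dx, dy)\<close> of two common cells satisfies \<open>2 dx = 0\<close> modulo \<open>n\<close>, and \<open>dx = 0\<close> forces
  \<open>dy = 0\<close>. So distinct common cells differ by exactly \<open>n / 2\<close> in the first coordinate, which is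
  impossible for all three pairs out of three cells. Two common cells do occur, for a plus and a minus
  diagonal when \<open>n\<close> is even.\<close>

lemma card_meet_le_2:
  assumes ij: "i < 4" "j < 4" "i \<noteq> j"
  shows "card {p \<in> board n. coord n i p = c \<and> coord n j p = d} \<le> 2" (is "card ?S \<le> 2")
proof (rule ccontr)
  assume "\<not> card ?S \<le> 2"
  then have "card ?S \<ge> 3" by simp
  then obtain T where T: "T \<subseteq> ?S" "card T = 3" by (meson obtain_subset_with_card_n)
  then obtain p q r where pqr: "p \<in> ?S" "q \<in> ?S" "r \<in> ?S" "p \<noteq> q" "q \<noteq> r" "p \<noteq> r"
    unfolding card_3_iff by blast
  have half: "2 * (int (fst u) - int (fst v)) = int n \<or> 2 * (int (fst u) - int (fst v)) = - int n"
    if u: "u \<in> ?S" and v: "v \<in> ?S" and ne: "u \<noteq> v" for u v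
  proof -
    define dx where "dx = int (fst u) - int (fst v)"
    define dy where "dy = int (snd u) - int (snd v)"
    have b: "\<bar>dx\<bar> < int n" "\<bar>dy\<bar> < int n"
      using u v by (auto simp: board_def dx_def dy_def)
    have D: "int n dvd (if k = 0 then dx else if k = 1 then dy else if k = 2 then dx + dy else dx - dy)"
      if "coord n k u = coord n k v" for k
      using that by (auto simp: coord_def mod_eq_dvd_iff dx_def dy_def algebra_simps split: if_splits)
    have Di: "int n dvd (if i = 0 then dx else if i = 1 then dy else if i = 2 then dx + dy else dx - dy)"
      and Dj: "int n dvd (if j = 0 then dx else if j = 1 then dy else if j = 2 then dx + dy else dx - dy)"
      using D u v by auto
    have two: "int n dvd 2 * dx" and z: "int n dvd dx \<Longrightarrow> int n dvd dy"
    proof -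
      have D2: "int n dvd 2 * a + 2 * b" "int n dvd a + b" "int n dvd 2 * a - 2 * b" "int n dvd 2 * a" "int n dvd 2 * b"
        if "int n dvd a" "int n dvd b" for a b :: int
        using that by (auto intro: dvd_add dvd_diff dvd_mult)
      show "int n dvd 2 * dx"
        using D2[OF Di Dj] D2(3)[OF Dj Di] ij(3) less_4_cases[OF ij(1)] less_4_cases[OF ij(2)]
        by (elim disjE) (simp_all add: algebra_simps)
      show "int n dvd dy" if Z: "int n dvd dx"
        using Di Dj dvd_diff[OF Di Z] dvd_diff[OF Dj Z] ij(3) less_4_cases[OF ij(1)] less_4_cases[OF ij(2)]
        by (elim disjE) simp_all
    qed
    obtain k where k: "2 * dx = int n * k" using two by (auto elim: dvdE)
    have "\<bar>int n * k\<bar> < int n * 2" using b k by linarith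
    moreover have "int n > 0" using b by linarith
    ultimately have "\<bar>k\<bar> < 2" by (simp add: abs_mult)
    moreover have "k \<noteq> 0"
    proof
      assume "k = 0"
      then have "dx = 0" using k by simp
      then have "dy = 0" using z b dvd_small_eq_0[of n dy] by simp
      with \<open>dx = 0\<close> ne show False by (simp add: dx_def dy_def prod_eq_iff)
    qed
    ultimately have "k = 1 \<or> k = -1" by linarith
    then show ?thesis using k unfolding dx_def by auto
  qed
  have "int n > 0" using pqr(1) by (auto simp: board_def)
  with half[OF pqr(1,2,4)] half[OF pqr(2,3,5)] half[OF pqr(1,3,6)] show False by smt
qed

section \<open>Cells removed by one queen\<close>

text \<open>The loss of a line without a queen, caused by a queen \<open>q\<close> off that line. Such a queen acts only through
  the three other families, hence the exclusion of \<open>i\<close>.\<close>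

definition killed :: "nat \<Rightarrow> (nat \<times> nat) set \<Rightarrow> nat \<Rightarrow> int \<Rightarrow> nat \<times> nat \<Rightarrow> (nat \<times> nat) set" where
  "killed n Q i c q =
     {v \<in> line_cells n Q i c. \<exists>j\<in>{..<4} - {i}. coord n j v = coord n j q}"

text \<open>The relation of \<open>killed\<close> read from the side of the cell \<open>v\<close>, over all admissible choices of \<open>q\<close>.\<close>

definition killers :: "nat \<Rightarrow> (nat \<times> nat) set \<Rightarrow> nat \<Rightarrow> int \<Rightarrow> nat \<times> nat \<Rightarrow> (nat \<times> nat) set" where
  "killers n Q i c v =
     {q \<in> available n Q. coord n i q \<noteq> c \<and> (\<exists>j\<in>{..<4} - {i}. coord n j v = coord n j q)}"

lemma finite_board_filter [simp]: "finite {p \<in> board n. P p}"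
  by (rule finite_subset[of _ "board n"]) (auto simp: board_def)

lemma card_union_meets_le_6:
  assumes "i < 4"
  shows "card (\<Union>j\<in>{..<4} - {i}. {p \<in> board n. coord n i p = c \<and> coord n j p = d j}) \<le> 6"
proof -
  have "card (\<Union>j\<in>{..<4} - {i}. {p \<in> board n. coord n i p = c \<and> coord n j p = d j})
      \<le> (\<Sum>j\<in>{..<4} - {i}. card {p \<in> board n. coord n i p = c \<and> coord n j p = d j})"
    by (rule card_UN_le) simp
  also have "\<dots> \<le> (\<Sum>j\<in>{..<4} - {i}. 2)"
    using assms by (intro sum_mono card_meet_le_2) auto
  also have "\<dots> = 6" using assms by simp
  finally show ?thesis .
qed

lemma available_subset_board: "available n Q \<subseteq> board n"
  by (auto simp: available_def)

lemma card_killed_le: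
  assumes "i < 4"
  shows "card (killed n Q i c q) \<le> 6"
proof -
  have "killed n Q i c q \<subseteq> (\<Union>j\<in>{..<4} - {i}. {p \<in> board n. coord n i p = c \<and> coord n j p = coord n j q})"
    using available_subset_board by (fastforce simp: killed_def line_cells_def)
  then have "card (killed n Q i c q) \<le> card (\<Union>j\<in>{..<4} - {i}. {p \<in> board n. coord n i p = c \<and> coord n j p = coord n j q})"
    by (intro card_mono) auto
  then show ?thesis using card_union_meets_le_6[OF assms, of n c "\<lambda>j. coord n j q"] by linarith
qed

lemma card_line_cells_insert:
  assumes Q: "Q \<subseteq> board n" and q: "q \<in> available n Q" and i: "i < 4" "coord n i q \<noteq> c"
  shows "real (card (line_cells n (insert q Q) i c)) =
     real (card (line_cells n Q i c)) - real (card (killed n Q i c q))"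
proof -
  have Q': "insert q Q \<subseteq> board n" using Q q available_subset_board by auto
  have "line_cells n (insert q Q) i c = line_cells n Q i c - killed n Q i c q"
    using i unfolding line_cells_def killed_def
    by (auto simp: available_iff_coord[OF Q] available_iff_coord[OF Q'])
  moreover have sub: "killed n Q i c q \<subseteq> line_cells n Q i c" by (auto simp: killed_def)
  ultimately show ?thesis
    using card_Diff_subset[OF finite_subset[OF sub] sub] card_mono[OF _ sub] by (simp add: of_nat_diff)
qed

text \<open>Double counting turns the expected loss of a line into counts of available cells on the lines that
  cross it, which are the quantities under control.\<close>

lemma sum_killed_eq_sum_killers:
  "(\<Sum>q\<in>available n Q. if coord n i q = c then 0 else card (killed n Q i c q)) =
     (\<Sum>v\<in>line_cells n Q i c. card (killers n Q i c v))"
proof -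
  let ?P = "\<lambda>q v. coord n i q \<noteq> c \<and> (\<exists>j\<in>{..<4} - {i}. coord n j v = coord n j q)"
  have "(\<Sum>q\<in>available n Q. if coord n i q = c then 0 else card (killed n Q i c q)) =
      (\<Sum>q\<in>available n Q. \<Sum>v\<in>line_cells n Q i c. if ?P q v then 1 else 0)"
    by (intro sum.cong refl) (auto simp: killed_def sum.inter_filter[symmetric])
  also have "\<dots> = (\<Sum>v\<in>line_cells n Q i c. \<Sum>q\<in>available n Q. if ?P q v then 1 else 0)"
    by (rule sum.swap)
  also have "\<dots> = (\<Sum>v\<in>line_cells n Q i c. card (killers n Q i c v))"
    by (intro sum.cong refl) (simp add: killers_def sum.inter_filter[symmetric])
  finally show ?thesis .
qed

lemma card_killers_le:
  "card (killers n Q i c v) \<le> (\<Sum>j\<in>{..<4} - {i}. card (line_cells n Q j (coord n j v)))"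
proof -
  have "card (killers n Q i c v) \<le> card (\<Union>j\<in>{..<4} - {i}. line_cells n Q j (coord n j v))"
    by (intro card_mono) (auto simp: killers_def line_cells_def)
  also have "\<dots> \<le> (\<Sum>j\<in>{..<4} - {i}. card (line_cells n Q j (coord n j v)))"
    by (rule card_UN_le) simp
  finally show ?thesis .
qed

text \<open>The three crossing lines through \<open>v\<close> overlap each other, and the given line, in at most two cells per
  pair. Discarding from each of them its meetings with the three other lines through \<open>v\<close> makes the
  remainders disjoint at the cost of six cells each.\<close>

lemma card_killers_ge:
  assumes i: "i < 4" and v: "coord n i v = c"
  shows "(\<Sum>j\<in>{..<4} - {i}. card (line_cells n Q j (coord n j v)) - 6) \<le> card (killers n Q i c v)"
proof -
  define M where "M j = (\<Union>k\<in>{..<4} - {j}. {p \<in> board n. coord n j p = coord n j v \<and> coord n k p = coord n k v})" for j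
  define D where "D j = line_cells n Q j (coord n j v) - M j" for j
  have fin: "finite (M j)" "finite (D j)" for j by (auto simp: M_def D_def)
  have "card (line_cells n Q j (coord n j v)) - 6 \<le> card (D j)" if "j \<in> {..<4} - {i}" for j
  proof -
    have "card (M j) \<le> 6" using that card_union_meets_le_6[of j] by (simp add: M_def)
    moreover have "card (line_cells n Q j (coord n j v)) - card (M j) \<le> card (D j)"
      unfolding D_def by (rule diff_card_le_card_Diff) (rule fin)
    ultimately show ?thesis by linarith
  qed
  then have "(\<Sum>j\<in>{..<4} - {i}. card (line_cells n Q j (coord n j v)) - 6) \<le> (\<Sum>j\<in>{..<4} - {i}. card (D j))"
    by (rule sum_mono)
  also have "\<dots> = card (\<Union>j\<in>{..<4} - {i}. D j)"
  proof (rule card_UN_disjoint[symmetric])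
    show "\<forall>j\<in>{..<4} - {i}. \<forall>k\<in>{..<4} - {i}. j \<noteq> k \<longrightarrow> D j \<inter> D k = {}"
      using available_subset_board[of n Q] by (auto simp: D_def M_def line_cells_def)
  qed (auto simp: fin)
  also have "\<dots> \<le> card (killers n Q i c v)"
  proof (rule card_mono)
    show "(\<Union>j\<in>{..<4} - {i}. D j) \<subseteq> killers n Q i c v"
    proof
      fix q assume "q \<in> (\<Union>j\<in>{..<4} - {i}. D j)"
      then obtain j where j: "j \<in> {..<4} - {i}" and q: "q \<in> line_cells n Q j (coord n j v)" "q \<notin> M j"
        by (auto simp: D_def)
      have "i \<in> {..<4} - {j}" using i j by auto
      then have "coord n i q \<noteq> coord n i v"
        using q available_subset_board[of n Q] unfolding M_def line_cells_def by blast
      then show "q \<in> killers n Q i c v"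
        using q(1) j v unfolding killers_def line_cells_def by (auto intro!: bexI[of _ j])
    qed
  qed (simp add: killers_def)
  finally show ?thesis .
qed

text \<open>The whole board needs no separate tracking: the open lines of one family partition the available
  cells.\<close>

lemma card_available_eq_sum:
  assumes "Q \<subseteq> board n" "n > 0" "i < 4"
  shows "card (available n Q) = (\<Sum>c\<in>open_lines n Q i. card (line_cells n Q i c))"
proof -
  have "available n Q = (\<Union>c\<in>open_lines n Q i. line_cells n Q i c)"
    using coord_available_open[OF assms(1,2) _ assms(3)] by (auto simp: line_cells_def)
  also have "card \<dots> = (\<Sum>c\<in>open_lines n Q i. card (line_cells n Q i c))"
    by (rule card_UN_disjoint) (auto simp: line_cells_def)
  finally show ?thesis .
qed

lemma card_open_lines:
  assumes "n > 0"
  shows "card (open_lines n Q i) = n - card (coord n i ` Q)"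
proof -
  have sub: "coord n i ` Q \<subseteq> {0..<int n}" using coord_range[OF assms] by blast
  then show ?thesis unfolding open_lines_def
    by (subst card_Diff_subset) (auto intro: finite_subset[OF sub])
qed

definition balanced :: "nat \<Rightarrow> (nat \<times> nat) set \<Rightarrow> real \<Rightarrow> real \<Rightarrow> bool" where
  "balanced n Q a g \<longleftrightarrow>
     (\<forall>i<4. \<forall>c\<in>open_lines n Q i. \<bar>real (card (line_cells n Q i c)) - a\<bar> \<le> g)"

lemma card_available_bounds:
  fixes a g :: real
  assumes Q: "Q \<subseteq> board n" and n: "n > 0" and t: "card (coord n 0 ` Q) = t" "t \<le> n"
    and bal: "balanced n Q a g"
  shows "(real n - real t) * (a - g) \<le> card (available n Q)"
    and "card (available n Q) \<le> (real n - real t) * (a + g)"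
proof -
  have c: "real (card (open_lines n Q 0)) = real n - real t"
    using card_open_lines[OF n, of Q 0] t by (simp add: of_nat_diff)
  have b: "a - g \<le> real (card (line_cells n Q 0 c)) \<and> real (card (line_cells n Q 0 c)) \<le> a + g"
    if "c \<in> open_lines n Q 0" for c
    using bal that unfolding balanced_def by (smt (verit) zero_less_numeral)
  have e: "real (card (available n Q)) = (\<Sum>c\<in>open_lines n Q 0. real (card (line_cells n Q 0 c)))"
    using card_available_eq_sum[OF Q n, of 0] by simp
  show "(real n - real t) * (a - g) \<le> card (available n Q)"
    unfolding e c[symmetric] using b by (intro sum_bounded_below) blast
  show "card (available n Q) \<le> (real n - real t) * (a + g)"
    unfolding e c[symmetric] using b by (intro sum_bounded_above) blast
qed

lemma killers_bounds:
  fixes a g :: real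
  assumes Q: "Q \<subseteq> board n" and n: "n > 0" and i: "i < 4"
    and bal: "balanced n Q a g" and v: "v \<in> line_cells n Q i c"
  shows "3 * (a - g) - 18 \<le> card (killers n Q i c v)"
    and "card (killers n Q i c v) \<le> 3 * (a + g)"
proof -
  have v': "v \<in> available n Q" "coord n i v = c" using v by (auto simp: line_cells_def)
  have b: "\<bar>real (card (line_cells n Q j (coord n j v))) - a\<bar> \<le> g" if "j \<in> {..<4} - {i}" for j
    using bal coord_available_open[OF Q n v'(1), of j] that unfolding balanced_def by blast
  have "3 * (a - g) - 18 = (\<Sum>j\<in>{..<4} - {i}. a - g - 6)" using i by simp
  also have "\<dots> \<le> (\<Sum>j\<in>{..<4} - {i}. real (card (line_cells n Q j (coord n j v)) - 6))"
  proof (rule sum_mono)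
    fix j assume "j \<in> {..<4} - {i}"
    from b[OF this] show "a - g - 6 \<le> real (card (line_cells n Q j (coord n j v)) - 6)" by linarith
  qed
  also have "\<dots> \<le> card (killers n Q i c v)"
    using card_killers_ge[OF i v'(2), of Q] unfolding of_nat_sum[symmetric] of_nat_le_iff .
  finally show "3 * (a - g) - 18 \<le> card (killers n Q i c v)" .
  have "real (card (killers n Q i c v)) \<le> (\<Sum>j\<in>{..<4} - {i}. real (card (line_cells n Q j (coord n j v))))"
    using card_killers_le[of n Q i c v] unfolding of_nat_sum[symmetric] of_nat_le_iff .
  also have "\<dots> \<le> (\<Sum>j\<in>{..<4} - {i}. a + g)"
  proof (rule sum_mono)
    fix j assume "j \<in> {..<4} - {i}"
    from b[OF this] show "real (card (line_cells n Q j (coord n j v))) \<le> a + g" by linarith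
  qed
  also have "\<dots> = 3 * (a + g)" using i by simp
  finally show "card (killers n Q i c v) \<le> 3 * (a + g)" .
qed

section \<open>Mean trajectory and drift\<close>

lemma exp_le_quadratic:
  fixes x :: real
  assumes "\<bar>x\<bar> \<le> 1"
  shows "exp x \<le> 1 + x + x\<^sup>2"
proof (cases "x \<ge> 0")
  case True
  then show ?thesis using exp_bound assms by simp
next
  case False
  define y where "y = - x"
  have y: "0 < y" using False by (simp add: y_def)
  have "exp x = 1 / exp y" by (simp add: y_def exp_minus inverse_eq_divide)
  also have "\<dots> \<le> 1 / (1 + y)" using y by (intro divide_left_mono) (auto simp: add_pos_pos)
  also have "\<dots> \<le> 1 - y + y\<^sup>2"
  proof -
    have "1 \<le> 1 + y ^ 3" using y by simp
    also have "\<dots> = (1 - y + y\<^sup>2) * (1 + y)" by (simp add: algebra_simps power2_eq_square power3_eq_cube)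
    finally show ?thesis using y by (simp add: divide_le_eq)
  qed
  finally show ?thesis by (simp add: y_def)
qed

text \<open>The moment generating function bound behind Azuma's inequality, for a uniform choice from \<open>S\<close>: the
  variance is estimated by \<open>K\<^sup>2\<close> only.\<close>

lemma sum_exp_le_exp_mean:
  fixes Y :: "'a \<Rightarrow> real"
  assumes fin: "finite S" and ne: "S \<noteq> {}" and Y: "\<And>q. q \<in> S \<Longrightarrow> \<bar>Y q\<bar> \<le> K" and z: "\<bar>z\<bar> * K \<le> 1"
  shows "(\<Sum>q\<in>S. exp (z * Y q)) \<le> card S * exp (z * (sum Y S / card S) + (z * K)\<^sup>2)"
proof -
  have c: "real (card S) > 0" using fin ne by (simp add: card_gt_0_iff)
  have "exp (z * Y q) \<le> 1 + z * Y q + (z * K)\<^sup>2" if q: "q \<in> S" for q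
  proof -
    have le: "\<bar>z * Y q\<bar> \<le> \<bar>z\<bar> * K" using Y[OF q] by (simp add: abs_mult mult_left_mono)
    have "(z * Y q)\<^sup>2 \<le> (\<bar>z\<bar> * K)\<^sup>2" using le power_mono[OF le, of 2] by simp
    moreover have "exp (z * Y q) \<le> 1 + z * Y q + (z * Y q)\<^sup>2"
      using le z by (intro exp_le_quadratic) linarith
    ultimately show ?thesis by (simp add: power_mult_distrib)
  qed
  then have "(\<Sum>q\<in>S. exp (z * Y q)) \<le> (\<Sum>q\<in>S. 1 + z * Y q + (z * K)\<^sup>2)" by (rule sum_mono)
  also have "\<dots> = card S * (1 + (z * (sum Y S / card S) + (z * K)\<^sup>2))"
    using c by (simp add: sum.distrib sum_distrib_left[symmetric] field_simps)
  also have "\<dots> \<le> card S * exp (z * (sum Y S / card S) + (z * K)\<^sup>2)"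
    using c by (intro mult_left_mono exp_ge_add_one_self) auto
  finally show ?thesis .
qed

text \<open>With \<open>m = n - t\<close> lines open per family, a cell on an open line has its three other lines open with
  probability about \<open>(m / n) ^ 3\<close>. This is the solution \<open>n p ^ 3\<close>, for \<open>p = 1 - t / n\<close>, of the differential
  equation that describes the mean of the process.\<close>

definition target :: "nat \<Rightarrow> nat \<Rightarrow> real" where
  "target n t = (real n - real t) ^ 3 / real n ^ 2"

text \<open>The allowed deviation from \<open>target\<close>. Deviations up to \<open>e\<close>, small relative to the target, change the drift of one line
  by at most \<open>12 e / m\<close>, up to a bounded multiple of \<open>1 / m\<close>. The exponent 13 lets the tolerance grow by
  \<open>13 e / m\<close> per step, which leaves \<open>e / m\<close> for all other errors.\<close>

definition tolerance :: "nat \<Rightarrow> real \<Rightarrow> nat \<Rightarrow> real" where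
  "tolerance n g t = g * (real n / (real n - real t)) ^ 13"

lemma target_step:
  assumes t: "t < n"
  defines "m \<equiv> real n - real t"
  shows "\<bar>target n t - target n (Suc t) - 3 * target n t / m\<bar> \<le> 3 / m"
proof -
  have m: "1 \<le> m" "m \<le> real n" using t by (auto simp: m_def)
  have n: "real n > 0" using t by simp
  have 1: "target n (Suc t) = (m - 1) ^ 3 / real n ^ 2" "target n t = m ^ 3 / real n ^ 2"
    by (simp_all add: target_def m_def algebra_simps)
  have 2: "target n t - target n (Suc t) - 3 * target n t / m = - ((3 * m - 1) / real n ^ 2)"
    unfolding 1 using m n by (simp add: field_simps power3_eq_cube power2_eq_square)
  have "m * m \<le> real n ^ 2" using m by (simp add: power2_eq_square mult_mono)
  have "(3 * m - 1) / real n ^ 2 \<le> 3 * m / (m * m)"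
    using m n \<open>m * m \<le> real n ^ 2\<close> by (intro frac_le) auto
  also have "\<dots> = 3 / m" using m by simp
  finally show ?thesis unfolding 2 using m by simp
qed

lemma tolerance_step:
  assumes t: "Suc t < n" and g: "g \<ge> 0"
  shows "tolerance n g t + 13 * tolerance n g t / (real n - real t) \<le> tolerance n g (Suc t)"
proof -
  define m where "m = real n - real t"
  have m: "m > 1" using t by (auto simp: m_def)
  have "1 + 13 / m \<le> 1 + real 13 * (1 / (m - 1))" using m by (simp add: frac_le)
  also have "\<dots> \<le> (1 + 1 / (m - 1)) ^ 13" using m by (intro Bernoulli_inequality) (simp add: order_trans[of _ 0])
  also have "\<dots> = (m / (m - 1)) ^ 13" using m by (simp add: field_simps)
  finally have *: "1 + 13 / m \<le> (m / (m - 1)) ^ 13" .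
  have "tolerance n g t + 13 * tolerance n g t / m = tolerance n g t * (1 + 13 / m)"
    by (simp add: algebra_simps)
  also have "\<dots> \<le> tolerance n g t * (m / (m - 1)) ^ 13"
    using * g m by (intro mult_left_mono) (auto simp: tolerance_def m_def)
  also have "\<dots> = tolerance n g (Suc t)"
  proof -
    have *: "real n - real (Suc t) = m - 1" by (simp add: m_def)
    show ?thesis using m unfolding tolerance_def m_def[symmetric] * by (simp add: power_divide)
  qed
  finally show ?thesis by (simp add: m_def)
qed

lemma tolerance_ge:
  assumes "t < n" "g \<ge> 0"
  shows "g \<le> tolerance n g t"
proof -
  have "1 \<le> (real n / (real n - real t)) ^ 13" using assms by (intro one_le_power) simp
  then show ?thesis unfolding tolerance_def using assms mult_left_mono[of 1 _ g] by simp
qed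

text \<open>Here \<open>M\<close> is the number of available cells, \<open>L\<close> the size of one line, \<open>S\<close> its total loss over all choices
  of the queen, and \<open>a\<close>, \<open>g\<close> the target and the tolerance. In the ideal case \<open>M = m a\<close>, \<open>L = a\<close>,
  \<open>S = 3 a\<^sup>2\<close> the mean loss is \<open>3 a / m\<close>.\<close>

lemma drift_bounds:
  fixes a g m :: real
  assumes m: "m > 0" and g: "0 < g" "g \<le> a / 5"
    and M: "m * (a - g) \<le> M" "M \<le> m * (a + g)"
    and L: "a - g \<le> L" "L \<le> a + g"
    and S: "L * (3 * (a - g) - 18) \<le> S" "S \<le> L * (3 * (a + g))"
  shows "\<bar>S / M - 3 * a / m\<bar> \<le> (12 * g + 27) / m"
proof -
  define w where "w = M / m"
  have Mw: "M = w * m" using m by (simp add: w_def)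
  have w: "a - g \<le> w" "w \<le> a + g" using M m by (auto simp: w_def field_simps)
  have w0: "w > 0" using w g by linarith
  have "S \<le> 3 * (a + g)\<^sup>2"
    using S(2) mult_right_mono[OF L(2), of "3 * (a + g)"] g by (simp add: power2_eq_square algebra_simps)
  also have "\<dots> \<le> (3 * a + 12 * g) * (a - g)"
  proof -
    have "(3 * a + 12 * g) * (a - g) - 3 * (a + g)\<^sup>2 = 3 * g * (a - 5 * g)"
      by (simp add: power2_eq_square algebra_simps)
    moreover have "0 \<le> 3 * g * (a - 5 * g)" using g by (intro mult_nonneg_nonneg) auto
    ultimately show ?thesis by linarith
  qed
  also have "\<dots> \<le> (3 * a + 12 * g) * w" using w g by (intro mult_left_mono) auto
  finally have "S / w \<le> 3 * a + 12 * g" using w0 by (simp add: divide_le_eq)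
  then have "S / w / m \<le> (3 * a + 12 * g) / m" using m by (intro divide_right_mono) auto
  then have up: "S / M - 3 * a / m \<le> 12 * g / m"
    by (simp add: Mw add_divide_distrib)
  have "(3 * a - 9 * g - 27) * w = (3 * a - 9 * g) * w - 27 * w" by (simp add: algebra_simps)
  also have "\<dots> \<le> (3 * a - 9 * g) * (a + g) - 27 * (a - g)"
    using w g by (intro diff_mono mult_left_mono) auto
  also have "\<dots> \<le> 3 * (a - g)\<^sup>2 - 18 * (a + g)"
  proof -
    have "3 * (a - g)\<^sup>2 - (3 * a - 9 * g) * (a + g) = 12 * g\<^sup>2"
      by (simp add: power2_eq_square algebra_simps)
    then have "(3 * a - 9 * g) * (a + g) \<le> 3 * (a - g)\<^sup>2"
      using zero_le_power2[of g] by (smt (verit))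
    moreover have "18 * (a + g) \<le> 27 * (a - g)" using g by simp
    ultimately show ?thesis by (rule diff_mono)
  qed
  also have "\<dots> \<le> S"
    using S(1) L(2) mult_right_mono[OF L(1), of "3 * (a - g)"] g by (simp add: power2_eq_square algebra_simps)
  finally have "3 * a - 9 * g - 27 \<le> S / w" using w0 by (simp add: le_divide_eq)
  then have "(3 * a - 9 * g - 27) / m \<le> S / w / m" using m by (intro divide_right_mono) auto
  then have lo: "- ((9 * g + 27) / m) \<le> S / M - 3 * a / m"
    by (simp add: Mw add_divide_distrib diff_divide_distrib)
  have "12 * g / m \<le> (12 * g + 27) / m" "(9 * g + 27) / m \<le> (12 * g + 27) / m"
    using m g by (auto intro: divide_right_mono)
  with up lo show ?thesis by linarith
qed

section \<open>An exponential potential\<close>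

text \<open>For \<open>s = 1\<close> and \<open>s = -1\<close> the weight penalises a line that is too full, respectively too empty. It is
  below 1 exactly while that deviation stays below the tolerance.\<close>

definition weight :: "nat \<Rightarrow> real \<Rightarrow> real \<Rightarrow> nat \<Rightarrow> (nat \<times> nat) set \<Rightarrow> nat \<Rightarrow> int \<Rightarrow> real \<Rightarrow> real" where
  "weight n l g t Q i c s =
     exp (l * (s * (real (card (line_cells n Q i c)) - target n t) - tolerance n g t))"

definition potential :: "nat \<Rightarrow> real \<Rightarrow> real \<Rightarrow> nat \<Rightarrow> (nat \<times> nat) set \<Rightarrow> real" where
  "potential n l g t Q = (\<Sum>i<4. \<Sum>c\<in>open_lines n Q i. \<Sum>s\<in>{-1, 1}. weight n l g t Q i c s)"

text \<open>All summands of the potential are positive, so a potential below 1 bounds every single deviation.\<close>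

lemma potential_less_1_imp_balanced:
  assumes "potential n l g t Q < 1" "l > 0"
  shows "balanced n Q (target n t) (tolerance n g t)"
  unfolding balanced_def
proof (intro allI impI ballI)
  fix i c assume i: "i < (4::nat)" and c: "c \<in> open_lines n Q i"
  let ?L = "real (card (line_cells n Q i c))"
  have pos: "0 \<le> weight n l g t Q i c s" for i c s by (simp add: weight_def)
  have s: "s * (?L - target n t) \<le> tolerance n g t" if "s \<in> {-1, 1}" for s
  proof -
    have "weight n l g t Q i c s \<le> (\<Sum>s\<in>{-1, 1}. weight n l g t Q i c s)"
      using that by (intro member_le_sum) (auto simp: pos)
    also have "\<dots> \<le> (\<Sum>c\<in>open_lines n Q i. \<Sum>s\<in>{-1, 1}. weight n l g t Q i c s)"
      using c by (intro member_le_sum[of c]) (auto simp: pos add_nonneg_nonneg)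
    also have "\<dots> \<le> potential n l g t Q"
      unfolding potential_def using i
      by (intro member_le_sum[of i "{..<4}" "\<lambda>i. \<Sum>c\<in>open_lines n Q i. \<Sum>s\<in>{-1, 1}. weight n l g t Q i c s"])
         (auto intro!: sum_nonneg add_nonneg_nonneg simp: pos)
    finally have "weight n l g t Q i c s < 1" using assms(1) by linarith
    then show ?thesis using assms(2) by (simp add: weight_def mult_less_0_iff)
  qed
  show "\<bar>?L - target n t\<bar> \<le> tolerance n g t" using s[of 1] s[of "-1"] by simp
qed

text \<open>On balanced configurations each weight is a supermartingale. The moment bound replaces the random loss
  \<open>Y\<close> of the line by its mean \<open>\<mu>\<close>, up to the second order term \<open>36 l\<close>; the decrease of the target cancels
  \<open>\<mu>\<close> up to an error that the growth of the tolerance absorbs. A line hit by the queen only drops out of the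
  potential, so its loss may be counted as 0.\<close>

lemma weight_step:
  assumes Q: "Q \<subseteq> board n" and t: "card (coord n 0 ` Q) = t" "Suc t < n"
    and bal: "balanced n Q (target n t) (tolerance n g t)"
    and small: "tolerance n g t \<le> target n t / 5"
    and l: "l > 0" "l * 6 \<le> 1" and g: "30 + 36 * l * real n \<le> g"
    and i: "i < 4" and c: "c \<in> open_lines n Q i" and s: "s \<in> {-1, 1}"
  shows "(\<Sum>q\<in>available n Q. if coord n i q = c then 0 else weight n l g (Suc t) (insert q Q) i c s)
      \<le> card (available n Q) * weight n l g t Q i c s"
proof -
  define A where "A = available n Q"
  define a where "a = target n t"
  define e where "e = tolerance n g t"
  define m where "m = real n - real t"
  define L where "L = real (card (line_cells n Q i c))"
  define Y where "Y q = (if coord n i q = c then 0 else real (card (killed n Q i c q)))" for q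
  define \<mu> where "\<mu> = sum Y A / card A"
  define d where "d = tolerance n g (Suc t) - e"
  have n: "n > 0" and m: "m > 0" "m \<le> n" using t by (auto simp: m_def)
  have g0: "g > 0" using g l n by (smt (verit) mult_nonneg_nonneg of_nat_0_le_iff)
  have e: "g \<le> e" "0 < e" "e \<le> a / 5"
    using tolerance_ge[of t n g] t g0 small by (auto simp: e_def a_def)
  have A: "m * (a - e) \<le> card A" "card A \<le> m * (a + e)"
    using card_available_bounds[OF Q n t(1) _ bal] t by (auto simp: A_def m_def a_def e_def)
  have "0 < m * (a - e)" using m e by (intro mult_pos_pos) auto
  then have A0: "real (card A) > 0" using A by linarith
  then have ne: "A \<noteq> {}" by auto
  have L: "a - e \<le> L" "L \<le> a + e"
    using bal i c by (auto simp: balanced_def L_def a_def e_def abs_le_iff) (smt (verit))+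
  have sumY: "sum Y A = (\<Sum>v\<in>line_cells n Q i c. real (card (killers n Q i c v)))"
  proof -
    have "sum Y A = real (\<Sum>q\<in>available n Q. if coord n i q = c then 0 else card (killed n Q i c q))"
      unfolding Y_def A_def of_nat_sum by (intro sum.cong) auto
    then show ?thesis unfolding sum_killed_eq_sum_killers by simp
  qed
  have S: "L * (3 * (a - e) - 18) \<le> sum Y A" "sum Y A \<le> L * (3 * (a + e))"
    unfolding sumY L_def using killers_bounds[OF Q n i bal]
    by (auto intro!: sum_bounded_below sum_bounded_above simp: a_def e_def)
  have "\<bar>\<mu> - 3 * a / m\<bar> \<le> (12 * e + 27) / m"
    unfolding \<mu>_def by (rule drift_bounds[OF m(1) e(2,3) A L S])
  moreover have "\<bar>a - target n (Suc t) - 3 * a / m\<bar> \<le> 3 / m"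
    using target_step[of t n] t by (simp add: a_def m_def)
  moreover have "13 * e / m \<le> d"
    using tolerance_step[of t n g] t g0 by (simp add: d_def e_def m_def)
  \<comment> \<open>The only place that uses the spare growth \<open>e / m\<close>; it fixes the lower bound on \<open>g\<close>.\<close>
  moreover have "(12 * e + 27) / m + 3 / m + 36 * l \<le> 13 * e / m"
  proof -
    have "36 * l * m \<le> 36 * l * n" using l m by (intro mult_left_mono) auto
    then have "12 * e + 27 + 3 + 36 * l * m \<le> 13 * e" using g e by linarith
    then have "(12 * e + 27 + 3 + 36 * l * m) / m \<le> 13 * e / m" using m by (intro divide_right_mono) auto
    then show ?thesis using m by (simp add: add_divide_distrib)
  qed
  ultimately have key: "s * (a - target n (Suc t)) - s * \<mu> + 36 * l \<le> d"
    using s by auto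
  \<comment> \<open>The weight after the step as it would be if the queen removed nothing from the line.\<close>
  define W where "W = exp (l * (s * (L - target n (Suc t)) - tolerance n g (Suc t)))"
  have "(\<Sum>q\<in>A. if coord n i q = c then 0 else weight n l g (Suc t) (insert q Q) i c s)
      \<le> (\<Sum>q\<in>A. W * exp (- (l * s) * Y q))"
  proof (rule sum_mono)
    fix q assume q: "q \<in> A"
    show "(if coord n i q = c then 0 else weight n l g (Suc t) (insert q Q) i c s) \<le> W * exp (- (l * s) * Y q)"
    proof (cases "coord n i q = c")
      case False
      note removed = card_line_cells_insert[OF Q q[unfolded A_def] i False]
      show ?thesis using False unfolding weight_def removed W_def Y_def L_def
        by (simp add: exp_add[symmetric] algebra_simps)
    qed (simp add: W_def)
  qed
  also have "\<dots> = W * (\<Sum>q\<in>A. exp (- (l * s) * Y q))" by (simp add: sum_distrib_left)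
  also have "\<dots> \<le> W * (card A * exp (- (l * s) * \<mu> + (- (l * s) * 6)\<^sup>2))"
  proof (intro mult_left_mono)
    show "(\<Sum>q\<in>A. exp (- (l * s) * Y q)) \<le> card A * exp (- (l * s) * \<mu> + (- (l * s) * 6)\<^sup>2)"
      unfolding \<mu>_def
    proof (rule sum_exp_le_exp_mean)
      show "\<bar>Y q\<bar> \<le> 6" for q using card_killed_le[OF i, of n Q c q] by (simp add: Y_def)
      show "\<bar>- (l * s)\<bar> * 6 \<le> 1" using l s by auto
    qed (use ne in \<open>auto simp: A_def\<close>)
  qed (simp add: W_def)
  also have "(- (l * s) * 6)\<^sup>2 = l * (36 * l)" using s by (auto simp: power2_eq_square)
  also have "W * (card A * exp (- (l * s) * \<mu> + l * (36 * l)))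
      = card A * exp (l * (s * (L - target n (Suc t)) - tolerance n g (Suc t) - s * \<mu> + 36 * l))"
    by (simp add: W_def exp_add[symmetric] algebra_simps)
  also have "\<dots> \<le> card A * exp (l * (s * (L - a) - e))"
  proof -
    have "s * (L - target n (Suc t)) = s * (L - a) + s * (a - target n (Suc t))" by (simp add: algebra_simps)
    then have "s * (L - target n (Suc t)) - tolerance n g (Suc t) - s * \<mu> + 36 * l \<le> s * (L - a) - e"
      using key unfolding d_def by linarith
    then show ?thesis using l by (intro mult_left_mono) auto
  qed
  finally show ?thesis by (simp add: A_def weight_def L_def a_def e_def)
qed

lemma open_lines_insert: "open_lines n (insert q Q) i = open_lines n Q i - {coord n i q}"
  by (auto simp: open_lines_def)

lemma potential_step:
  assumes Q: "Q \<subseteq> board n" and t: "card (coord n 0 ` Q) = t" "Suc t < n"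
    and bal: "balanced n Q (target n t) (tolerance n g t)"
    and small: "tolerance n g t \<le> target n t / 5"
    and l: "l > 0" "l * 6 \<le> 1" and g: "30 + 36 * l * real n \<le> g"
  shows "(\<Sum>q\<in>available n Q. potential n l g (Suc t) (insert q Q))
      \<le> card (available n Q) * potential n l g t Q"
proof -
  let ?w = "\<lambda>q i c s. if coord n i q = c then 0 else weight n l g (Suc t) (insert q Q) i c s"
  have "potential n l g (Suc t) (insert q Q) = (\<Sum>i<4. \<Sum>c\<in>open_lines n Q i. \<Sum>s\<in>{-1, 1}. ?w q i c s)" for q
    unfolding potential_def
  proof (rule sum.cong[OF refl])
    fix i
    have "(\<Sum>c\<in>open_lines n Q i. \<Sum>s\<in>{-1, 1}. ?w q i c s) = (\<Sum>c\<in>open_lines n Q i - {coord n i q}. \<Sum>s\<in>{-1, 1}. ?w q i c s)"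
      by (rule sum.mono_neutral_right) auto
    also have "\<dots> = (\<Sum>c\<in>open_lines n Q i - {coord n i q}. \<Sum>s\<in>{-1, 1}. weight n l g (Suc t) (insert q Q) i c s)"
      by (intro sum.cong refl) auto
    finally show "(\<Sum>c\<in>open_lines n (insert q Q) i. \<Sum>s\<in>{-1, 1}. weight n l g (Suc t) (insert q Q) i c s) =
        (\<Sum>c\<in>open_lines n Q i. \<Sum>s\<in>{-1, 1}. ?w q i c s)"
      by (simp only: open_lines_insert)
  qed
  then have "(\<Sum>q\<in>available n Q. potential n l g (Suc t) (insert q Q)) =
      (\<Sum>q\<in>available n Q. \<Sum>i<4. \<Sum>c\<in>open_lines n Q i. \<Sum>s\<in>{-1, 1}. ?w q i c s)"
    by (simp only:)
  also have "\<dots> = (\<Sum>i<4. \<Sum>q\<in>available n Q. \<Sum>c\<in>open_lines n Q i. \<Sum>s\<in>{-1, 1}. ?w q i c s)"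
    by (rule sum.swap)
  also have "\<dots> = (\<Sum>i<4. \<Sum>c\<in>open_lines n Q i. \<Sum>q\<in>available n Q. \<Sum>s\<in>{-1, 1}. ?w q i c s)"
    by (intro sum.cong refl) (rule sum.swap)
  also have "\<dots> = (\<Sum>i<4. \<Sum>c\<in>open_lines n Q i. \<Sum>s\<in>{-1, 1}. \<Sum>q\<in>available n Q. ?w q i c s)"
    by (intro sum.cong refl) (rule sum.swap)
  also have "\<dots> \<le> (\<Sum>i<4. \<Sum>c\<in>open_lines n Q i. \<Sum>s\<in>{-1, 1}. card (available n Q) * weight n l g t Q i c s)"
    by (intro sum_mono weight_step[OF Q t bal small l g]) auto
  also have "\<dots> = card (available n Q) * potential n l g t Q"
    by (simp only: potential_def sum_distrib_left)
  finally show ?thesis .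
qed

section \<open>The potential along the random process\<close>

text \<open>Truncating at 1 replaces a stopping time: at value 1 the score cannot increase further, and below 1 the
  configuration is balanced, so that the one-step estimate applies. An abort has score 1. The condition on
  the columns leaves \<open>n - t\<close> of them open, which ties the number of available cells to \<open>t\<close>.\<close>

definition score :: "nat \<Rightarrow> real \<Rightarrow> real \<Rightarrow> nat \<Rightarrow> (nat \<times> nat) set option \<Rightarrow> real" where
  "score n l g t s = (case s of None \<Rightarrow> 1 | Some Q \<Rightarrow>
     if Q \<subseteq> board n \<and> card (coord n 0 ` Q) = t then min 1 (potential n l g t Q) else 1)"

lemma potential_nonneg: "0 \<le> potential n l g t Q"
  unfolding potential_def weight_def by (intro sum_nonneg) auto

lemma score_range: "0 \<le> score n l g t s" "score n l g t s \<le> 1"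
  using potential_nonneg by (auto simp: score_def split: option.split)

lemma integrable_score [simp]: "integrable (measure_pmf p) (score n l g t)"
  by (rule measure_pmf.integrable_const_bound[where B = 1]) (auto simp: score_range)

lemma score_step:
  assumes t: "Suc t < n" and small: "tolerance n g t \<le> target n t / 5"
    and l: "l > 0" "l * 6 \<le> 1" and g: "30 + 36 * l * real n \<le> g"
  shows "measure_pmf.expectation (case s of None \<Rightarrow> return_pmf None | Some Q \<Rightarrow> greedy_step n Q)
      (score n l g (Suc t)) \<le> score n l g t s"
proof (cases "\<exists>Q. s = Some Q \<and> Q \<subseteq> board n \<and> card (coord n 0 ` Q) = t \<and> potential n l g t Q < 1")
  case False
  have "score n l g t s = 1"
  proof (cases s)
    case (Some Q)
    show ?thesis
    proof (cases "Q \<subseteq> board n \<and> card (coord n 0 ` Q) = t")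
      case True
      then have "1 \<le> potential n l g t Q" using False Some by (metis linorder_not_less)
      then have "min 1 (potential n l g t Q) = 1" by (rule min_absorb1)
      then show ?thesis unfolding score_def Some option.case by (simp only: True simp_thms if_True)
    qed (simp only: score_def Some option.case if_False)
  qed (simp add: score_def)
  moreover have "measure_pmf.expectation p (score n l g (Suc t)) \<le> 1" for p
    by (rule measure_pmf.integral_le_const[OF integrable_score]) (simp add: score_range)
  ultimately show ?thesis by simp
next
  case True
  then obtain Q where s: "s = Some Q" and Q: "Q \<subseteq> board n" "card (coord n 0 ` Q) = t"
    and pot: "potential n l g t Q < 1" by blast
  have n: "n > 0" using t by simp
  have bal: "balanced n Q (target n t) (tolerance n g t)"
    by (rule potential_less_1_imp_balanced[OF pot l(1)])
  have "g > 0" using g l n by (smt (verit) mult_nonneg_nonneg of_nat_0_le_iff)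
  then have "0 < tolerance n g t" using tolerance_ge[of t n g] t by linarith
  then have "0 < (real n - real t) * (target n t - tolerance n g t)"
    using small t by (intro mult_pos_pos) auto
  also have "\<dots> \<le> card (available n Q)"
    using card_available_bounds(1)[OF Q(1) n Q(2) _ bal] t by simp
  finally have A0: "real (card (available n Q)) > 0" .
  then have ne: "available n Q \<noteq> {}" by auto
  have "measure_pmf.expectation (greedy_step n Q) (score n l g (Suc t))
      = (\<Sum>q\<in>available n Q. score n l g (Suc t) (Some (insert q Q))) / card (available n Q)"
    using ne by (simp add: greedy_step_def integral_pmf_of_set)
  also have "\<dots> \<le> (\<Sum>q\<in>available n Q. potential n l g (Suc t) (insert q Q)) / card (available n Q)"
  proof (intro divide_right_mono sum_mono)
    fix q assume q: "q \<in> available n Q"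
    have "coord n 0 ` Q \<subseteq> {0..<int n}" using coord_range[OF n] by blast
    then have fin: "finite (coord n 0 ` Q)" by (rule finite_subset) simp
    have "coord n 0 q \<notin> coord n 0 ` Q" using q Q(1) by (simp add: available_iff_coord)
    then have "card (coord n 0 ` insert q Q) = Suc t" using fin Q(2) by simp
    moreover have "insert q Q \<subseteq> board n" using q Q(1) available_subset_board by auto
    ultimately show "score n l g (Suc t) (Some (insert q Q)) \<le> potential n l g (Suc t) (insert q Q)"
      by (simp add: score_def)
  qed simp
  also have "\<dots> \<le> potential n l g t Q"
    using potential_step[OF Q t bal small l g] A0 by (simp add: divide_le_eq mult.commute)
  also have "\<dots> = score n l g t s" using s Q pot by (simp add: score_def)
  finally show ?thesis using s by simp
qed

lemma expectation_bind_le: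
  fixes f :: "'b \<Rightarrow> real" and h :: "'a \<Rightarrow> real"
  assumes f: "\<And>y. 0 \<le> f y" "\<And>y. f y \<le> B" and h: "integrable (measure_pmf p) h"
    and le: "\<And>x. measure_pmf.expectation (k x) f \<le> h x"
  shows "measure_pmf.expectation (bind_pmf p k) f \<le> measure_pmf.expectation p h"
proof -
  have B: "\<bar>f y\<bar> \<le> B" for y using f[of y] by simp
  have "measure_pmf.expectation (bind_pmf p k) f = measure_pmf.expectation p (\<lambda>x. measure_pmf.expectation (k x) f)"
    unfolding measure_pmf_bind
    by (rule integral_bind[where K = "count_space UNIV" and B' = 1 and B = B])
       (auto simp: B measure_pmf.emeasure_le_1 measurable_measure_pmf measure_pmf_in_subprob_space)
  also have "\<dots> \<le> measure_pmf.expectation p h"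
  proof (rule integral_mono)
    show "integrable (measure_pmf p) (\<lambda>x. measure_pmf.expectation (k x) f)"
    proof (rule measure_pmf.integrable_const_bound[where B = B])
      have "0 \<le> measure_pmf.expectation (k x) f" "measure_pmf.expectation (k x) f \<le> B" for x
      proof -
        have int: "integrable (measure_pmf (k x)) f"
          by (rule measure_pmf.integrable_const_bound[where B = B]) (auto simp: B)
        show "0 \<le> measure_pmf.expectation (k x) f" using f(1) by (intro integral_nonneg_AE) auto
        show "measure_pmf.expectation (k x) f \<le> B"
          by (rule measure_pmf.integral_le_const[OF int]) (simp add: f)
      qed
      then show "AE x in measure_pmf p. norm (measure_pmf.expectation (k x) f) \<le> B" by simp
    qed simp
  qed (use h le in auto)
  finally show ?thesis .
qed

lemma expectation_score_le:
  assumes small: "\<And>u. u < t \<Longrightarrow> tolerance n g u \<le> target n u / 5" and t: "t < n"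
    and l: "l > 0" "l * 6 \<le> 1" and g: "30 + 36 * l * real n \<le> g"
  shows "measure_pmf.expectation (toroidal_greedy n t) (score n l g t) \<le> score n l g 0 (Some {})"
  using small t
proof (induction t)
  case (Suc t)
  have "measure_pmf.expectation (toroidal_greedy n (Suc t)) (score n l g (Suc t))
      \<le> measure_pmf.expectation (toroidal_greedy n t) (score n l g t)"
    unfolding toroidal_greedy.simps
    by (rule expectation_bind_le[where B = 1])
       (use Suc.prems score_step[OF _ _ l g] score_range in auto)
  also have "\<dots> \<le> score n l g 0 (Some {})" using Suc by simp
  finally show ?case .
qed simp

text \<open>On the empty board every line has exactly \<open>n\<close> available cells, which is the target, so only the
  tolerance contributes to the \<open>8 n\<close> weights.\<close>

lemma potential_empty:
  assumes n: "n > 0"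
  shows "potential n l g 0 {} = 8 * real n * exp (- (l * g))"
proof -
  have "available n {} = board n" by (auto simp: available_def)
  then have "card (line_cells n {} i c) = n" if "i < 4" "c \<in> open_lines n {} i" for i c
    using card_board_line[OF n _ that(1), of c] that by (simp add: line_cells_def open_lines_def)
  then have "weight n l g 0 {} i c s = exp (- (l * g))" if "i < 4" "c \<in> open_lines n {} i" for i c s
    using that n by (simp add: weight_def target_def tolerance_def power2_eq_square power3_eq_cube)
  then have "potential n l g 0 {} = (\<Sum>i<4. \<Sum>c\<in>open_lines n {} i. \<Sum>s\<in>{-1, 1 :: real}. exp (- (l * g)))"
    unfolding potential_def by (intro sum.cong refl) auto
  then show ?thesis using n by (simp add: open_lines_def)
qed

lemma abort_probability_le:
  assumes small: "\<And>u. u < t \<Longrightarrow> tolerance n g u \<le> target n u / 5" and t: "t < n"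
    and l: "l > 0" "l * 6 \<le> 1" and g: "30 + 36 * l * real n \<le> g"
  shows "measure_pmf.prob (toroidal_greedy n t) {None} \<le> 8 * real n * exp (- (l * g))"
proof -
  have "measure_pmf.prob (toroidal_greedy n t) {None} = measure_pmf.expectation (toroidal_greedy n t) (indicator {None})"
    by simp
  also have "\<dots> \<le> measure_pmf.expectation (toroidal_greedy n t) (score n l g t)"
  proof (rule integral_mono)
    show "integrable (toroidal_greedy n t) (indicat_real {None})"
      by (rule measure_pmf.integrable_const_bound[where B = 1]) (auto simp: indicator_def)
    show "indicat_real {None} s \<le> score n l g t s" for s
      using score_range(1)[of n l g t s] by (cases s) (simp_all add: score_def)
  qed simp
  also have "\<dots> \<le> score n l g 0 (Some {})" by (rule expectation_score_le[OF small t l g])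
  also have "\<dots> \<le> potential n l g 0 {}" by (simp add: score_def)
  finally show ?thesis using potential_empty t by simp
qed

section \<open>Asymptotics\<close>

lemma frac_le_fracI:
  fixes a b c d :: real
  shows "0 < b \<Longrightarrow> 0 < d \<Longrightarrow> a * d \<le> c * b \<Longrightarrow> a / b \<le> c / d"
  by (simp add: field_simps)

text \<open>The ratio of tolerance to target is \<open>g n ^ 15 / k ^ 16\<close> for \<open>k = n - t\<close>, hence largest at the end of the
  run.\<close>

lemma tolerance_le_target:
  assumes n: "n > 0" and g: "g > 0" and m: "m > 0" "m \<le> real n - real t"
    and le: "5 * (g * real n ^ 15) \<le> m ^ 16"
  shows "tolerance n g t \<le> target n t / 5"
proof -
  define k where "k = real n - real t"
  have k: "0 < k" using m by (simp add: k_def)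
  have "m ^ 16 \<le> k ^ 16" using m by (intro power_mono) (auto simp: k_def)
  then have "5 * (g * real n ^ 15) \<le> k ^ 16" using le by linarith
  moreover have "k ^ 16 = k ^ 3 * k ^ 13" "real n ^ 15 = real n ^ 13 * real n ^ 2"
    by (simp_all flip: power_add)
  ultimately have cross: "(g * real n ^ 13) * (real n ^ 2 * 5) \<le> k ^ 3 * k ^ 13"
    by (simp only: mult_ac)
  have "g * real n ^ 13 / k ^ 13 \<le> k ^ 3 / (real n ^ 2 * 5)"
    by (rule frac_le_fracI[OF _ _ cross]) (use k n in simp_all)
  then show ?thesis
    unfolding tolerance_def target_def k_def[symmetric] power_divide by simp
qed

lemma greedy_time_bound:
  assumes n: "n > 0"
  shows "real n powr (1 - 1 / 10 ^ 4) \<le> real n - real (greedy_time n)"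
proof -
  have "real n powr (- greedy_alpha) \<le> 1"
    using powr_mono[of "- greedy_alpha" 0 "real n"] n by (simp add: greedy_alpha_def)
  then have "real (greedy_time n) \<le> (1 - real n powr (- greedy_alpha)) * real n"
    unfolding greedy_time_def by (simp add: of_nat_floor)
  moreover have "real n powr (- greedy_alpha) * real n = real n powr (1 - 1 / 10 ^ 4)"
  proof -
    have "real n powr (- greedy_alpha) * real n powr 1 = real n powr (1 - 1 / 10 ^ 4)"
      unfolding powr_add[symmetric] greedy_alpha_def by simp
    then show ?thesis using n by simp
  qed
  ultimately show ?thesis by (simp add: algebra_simps)
qed

text \<open>Comparing exponents: \<open>3 / 4 + 15\<close> is less than \<open>16 (1 - 1 / 10 ^ 4)\<close>.\<close>

lemma eventually_tolerance_le_target: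
  "\<forall>\<^sub>F n in sequentially. 5 * (real n powr (3/4) * real n ^ 15) \<le> (real n powr (1 - 1 / 10 ^ 4)) ^ 16"
proof -
  have "\<forall>\<^sub>F n in sequentially. 5 * (real n powr (3/4) * real n powr 15) \<le> real n powr (16 * (1 - 1 / 10 ^ 4))"
    by real_asymp
  then show ?thesis using eventually_gt_at_top[of 0]
  proof eventually_elim
    case (elim n)
    have 1: "real n powr 15 = real n ^ 15" using powr_realpow[of "real n" 15] elim(2) by simp
    have 2: "(real n powr (1 - 1 / 10 ^ 4)) ^ 16 = real n powr (16 * (1 - 1 / 10 ^ 4))"
      using elim(2) by (subst powr_power) simp_all
    show ?case using elim(1) unfolding 1 2 .
  qed
qed

lemma eventually_initial:
  "\<forall>\<^sub>F n in sequentially. 8 * real n * exp (- (real n powr (-1/2) * real n powr (3/4))) \<le> exp (- (real n powr (1/100)))"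
  by real_asymp

lemma eventually_step_condition:
  "\<forall>\<^sub>F n in sequentially. 30 + 36 * real n powr (-1/2) * real n \<le> real n powr (3/4)"
  by real_asymp

lemma eventually_rate:
  "\<forall>\<^sub>F n in sequentially. real n powr (-1/2) * 6 \<le> 1"
  by real_asymp

theorem mainTheorem3:
  shows "\<exists>c::real. c > 0 \<and> (\<exists>n0::nat. \<forall>n\<ge>n0.
           measure_pmf.prob (toroidal_greedy n (greedy_time n)) {s. s \<noteq> None}
             \<ge> 1 - exp (- c * real n powr (1 / 100)))"
proof -
  have "\<forall>\<^sub>F n in sequentially. measure_pmf.prob (toroidal_greedy n (greedy_time n)) {s. s \<noteq> None}
             \<ge> 1 - exp (- 1 * real n powr (1 / 100))"
    using eventually_tolerance_le_target eventually_initial eventually_step_condition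
      eventually_rate eventually_gt_at_top[of 0]
  proof eventually_elim
    case (elim n)
    \<comment> \<open>The fluctuations of a line have order \<open>sqrt n\<close>. The rate \<open>l\<close> is of the inverse order, and the slack
      \<open>g\<close> exceeds that order by the factor \<open>n powr (1/4)\<close>; this factor is the exponent \<open>l g\<close>.\<close>
    define l where "l = real n powr (-1/2)"
    define g where "g = real n powr (3/4)"
    define m where "m = real n powr (1 - 1 / 10 ^ 4)"
    define T where "T = greedy_time n"
    have pos: "l > 0" "g > 0" "m > 0" using elim(5) by (simp_all add: l_def g_def m_def)
    have mT: "m \<le> real n - real T" unfolding m_def T_def using greedy_time_bound elim(5) .
    then have T: "T < n" using pos(3) by linarith
    have "tolerance n g u \<le> target n u / 5" if "u < T" for u
      using elim(1,5) pos mT that by (intro tolerance_le_target[of n g m]) (auto simp: g_def m_def)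
    then have "measure_pmf.prob (toroidal_greedy n T) {None} \<le> 8 * real n * exp (- (l * g))"
      using elim pos T by (intro abort_probability_le) (auto simp: l_def g_def)
    also have "\<dots> \<le> exp (- (real n powr (1/100)))"
      using elim(2) by (simp add: l_def g_def)
    finally have "measure_pmf.prob (toroidal_greedy n T) {None} \<le> exp (- (real n powr (1/100)))" .
    moreover have "measure_pmf.prob (toroidal_greedy n T) {s. s \<noteq> None}
        = 1 - measure_pmf.prob (toroidal_greedy n T) {None}"
    proof -
      have "{s. s \<noteq> None} = UNIV - {None :: (nat \<times> nat) set option}" by auto
      then show ?thesis using measure_pmf.prob_compl[of "{None}" "toroidal_greedy n T"] by simp
    qed
    ultimately show ?case by (simp add: T_def)
  qed
  then obtain n0 where "\<forall>n\<ge>n0. measure_pmf.prob (toroidal_greedy n (greedy_time n)) {s. s \<noteq> None}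
             \<ge> 1 - exp (- 1 * real n powr (1 / 100))"
    unfolding eventually_sequentially by blast
  then show ?thesis by (intro exI[of _ 1] conjI exI[of _ n0]) auto
qed

end
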